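(* Let $\mathsf S\in\{\mathsf K,\mathsf T,\mathsf F\}$ and let $\mathsf C_{\mathsf S}$ be the class of $\mathsf S$-algebras. Then for all $\Gamma\subseteq\mathsf{Form}$ and $\varphi\in\mathsf{Form}$: $\Gamma\vdash_{\mathsf S}\varphi$ if and only if $\Gamma\vDash_{\mathsf C_{\mathsf S}}\varphi$.
   Context: **Language.** $\mathsf{Prop}$ is a countable set of propositional variables; $\mathsf{Form}$ is generated by $\varphi::=p\mid\bot\mid\top\mid(\varphi\wedge\varphi)\mid(\varphi\vee\varphi)\mid(\varphi\to\varphi)$, $p\in\mathsf{Prop}$, and $\neg\alpha:=\alpha\to\bot$. **Systems.** For relations ${\vdash}\subseteq\wp(\mathsf{Form})\times\mathsf{Form}$ write $\Gamma,\varphi\vdash\psi$ for $\Gamma\cup\{\varphi\}\vdash\psi$, $\varphi\vdash\psi$ for $\{\varphi\}\vdash\psi$, $\vdash\varphi$ for $\varnothing\vdash\varphi$, and $\alpha\dashv\vdash\beta$ for $\alpha\vdash\beta$ and $\beta\vdash\alpha$. $\vdash_{\mathsf K}$ is the smallest such relation satisfying, for all sets $\Gamma,\Delta$ and formulas: (A) $\Gamma,\varphi\vdash\varphi$; (Cut) if $\Gamma,\psi\vdash\varphi$ and $\Delta\vdash\psi$ then $\Gamma\cup\Delta\vdash\varphi$; ($\wedge$I) $\{\varphi,\psi\}\vdash\varphi\wedge\psi$; ($\wedge$E) $\varphi\wedge\psi\vdash\varphi$ and $\varphi\wedge\psi\vdash\psi$; ($\vee$I) $\varphi\vdash\varphi\vee\psi$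 and $\psi\vdash\varphi\vee\psi$; ($\vee$E) if $\varphi\vdash\alpha$ and $\psi\vdash\alpha$ then $\varphi\vee\psi\vdash\alpha$; ($\bot$E) $\bot\vdash\varphi$; ($\top$) $\vdash\top$; ($\top\to$E) $\top\to\varphi\vdash\varphi$; (Con) if $\alpha\wedge\beta\vdash\psi$ then $\alpha\to\beta\vdash\alpha\to\psi$; ($\wedge{\vdash}\to$) $\alpha\wedge\beta\vdash\alpha\to\beta$; (Imp) if $\alpha\wedge\beta\vdash\varphi$ then $\varphi\to(\alpha\to\beta)\vdash(\varphi\wedge\alpha)\to\beta$; (Rep) if $\alpha\dashv\vdash\alpha'$ then $\alpha\to\beta\dashv\vdash\alpha'\to\beta$. $\vdash_{\mathsf T}$ is the smallest relation satisfying these conditions together with ($\to$Id) $\vdash\alpha\to\alpha$ and (Exp) $\{\alpha,\neg\alpha\}\vdash\bot$. $\vdash_{\mathsf F}$ is the smallest relation satisfying all of these together with ($\neg\neg$I) $\alpha\vdash\neg\neg\alpha$. **Algebras.** A *preconditional* on a bounded lattice $L$ (with bounds $0,1$) is a binary operation $\to$ on $L$ satisfying, for all $a,b,c\in L$: (P1) $1\to a\le a$; (P2) $a\wedge b\le a\to b$; (P3) $a\to b\le a\to(a\wedge b)$; (P4) $a\to(b\wedge c)\le a\to b$; (P5) $a\to((a\wedge b)\to c)\le(a\wedge b)\to c$. Put $\neg a:=a\to0$. A *$\mathsf K$-algebra* is a pair $(L,\to)$ of a bounded lattice and a preconditional on it. A *$\mathsf T$-algebra* is a $\mathsf K$-algebra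 with $a\to a=1$ and $a\wedge\neg a=0$ for all $a$. An *$\mathsf F$-algebra* is a $\mathsf T$-algebra with $a\le\neg\neg a$ for all $a$. **Algebraic consequence.** A valuation $\theta:\mathsf{Prop}\to L$ extends uniquely to $\tilde\theta:\mathsf{Form}\to L$ with $\tilde\theta(\bot)=0$, $\tilde\theta(\top)=1$ and commuting with $\wedge,\vee,\to$. $\Gamma\vDash_{\mathsf C}\varphi$ means: for every $(L,\to)\in\mathsf C$ and every valuation $\theta$ into $L$, there are $\gamma_1,\dots,\gamma_n\in\Gamma$ (possibly $n=0$) with $\tilde\theta(\gamma_1)\wedge\dots\wedge\tilde\theta(\gamma_n)\le\tilde\theta(\varphi)$, where the empty meet is $1$. *)

theory Defs
  imports "HOL-Algebra.Lattice" "HOL-Library.Countable"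
begin

datatype 'p form =
    Var 'p
  | Bot (\<open>\<^bold>\<bottom>\<close>)
  | Top (\<open>\<^bold>\<top>\<close>)
  | And "'p form" "'p form" (infixr \<open>\<^bold>\<and>\<close> 75)
  | Or "'p form" "'p form" (infixr \<open>\<^bold>\<or>\<close> 74)
  | Imp "'p form" "'p form" (infixr \<open>\<^bold>\<longrightarrow>\<close> 73)

abbreviation Neg :: "'p form \<Rightarrow> 'p form" (\<open>\<^bold>\<not> _\<close> [76] 76)
  where "\<^bold>\<not> \<alpha> \<equiv> \<alpha> \<^bold>\<longrightarrow> \<^bold>\<bottom>"

datatype sys = SysK | SysT | SysF

text \<open>The three consequence relations are generated together: the rules \<open>ImpId\<close> and \<open>Exp\<close>
  are available in the systems T and F only, and \<open>NegNegI\<close> in F only.\<close>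

inductive derives :: "sys \<Rightarrow> 'p form set \<Rightarrow> 'p form \<Rightarrow> bool" for S :: sys where
  Ax: "derives S (insert \<phi> \<Gamma>) \<phi>"
| Cut: "derives S (insert \<psi> \<Gamma>) \<phi> \<Longrightarrow> derives S \<Delta> \<psi> \<Longrightarrow> derives S (\<Gamma> \<union> \<Delta>) \<phi>"
| AndI: "derives S {\<phi>, \<psi>} (\<phi> \<^bold>\<and> \<psi>)"
| AndE1: "derives S {\<phi> \<^bold>\<and> \<psi>} \<phi>"
| AndE2: "derives S {\<phi> \<^bold>\<and> \<psi>} \<psi>"
| OrI1: "derives S {\<phi>} (\<phi> \<^bold>\<or> \<psi>)"
| OrI2: "derives S {\<psi>} (\<phi> \<^bold>\<or> \<psi>)"
| OrE: "derives S {\<phi>} \<alpha> \<Longrightarrow> derives S {\<psi>} \<alpha> \<Longrightarrow> derives S {\<phi> \<^bold>\<or> \<psi>} \<alpha>"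
| BotE: "derives S {\<^bold>\<bottom>} \<phi>"
| TopI: "derives S {} \<^bold>\<top>"
| TopImpE: "derives S {\<^bold>\<top> \<^bold>\<longrightarrow> \<phi>} \<phi>"
| Con: "derives S {\<alpha> \<^bold>\<and> \<beta>} \<psi> \<Longrightarrow> derives S {\<alpha> \<^bold>\<longrightarrow> \<beta>} (\<alpha> \<^bold>\<longrightarrow> \<psi>)"
| AndImp: "derives S {\<alpha> \<^bold>\<and> \<beta>} (\<alpha> \<^bold>\<longrightarrow> \<beta>)"
| ImpR: "derives S {\<alpha> \<^bold>\<and> \<beta>} \<phi> \<Longrightarrow>
    derives S {\<phi> \<^bold>\<longrightarrow> (\<alpha> \<^bold>\<longrightarrow> \<beta>)} ((\<phi> \<^bold>\<and> \<alpha>) \<^bold>\<longrightarrow> \<beta>)"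
| Rep: "derives S {\<alpha>} \<alpha>' \<Longrightarrow> derives S {\<alpha>'} \<alpha> \<Longrightarrow> derives S {\<alpha> \<^bold>\<longrightarrow> \<beta>} (\<alpha>' \<^bold>\<longrightarrow> \<beta>)"
  \<comment> \<open>The premises are symmetric, so this one conclusion yields both directions of the
      interderivability of the two conditionals.\<close>
| ImpId: "S \<in> {SysT, SysF} \<Longrightarrow> derives S {} (\<alpha> \<^bold>\<longrightarrow> \<alpha>)"
| Exp: "S \<in> {SysT, SysF} \<Longrightarrow> derives S {\<alpha>, \<^bold>\<not> \<alpha>} \<^bold>\<bottom>"
| NegNegI: "S = SysF \<Longrightarrow> derives S {\<alpha>} (\<^bold>\<not> (\<^bold>\<not> \<alpha>))"

text \<open>Algebras are lattices with an explicit carrier set, so that lattices of any cardinality up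
  to that of the ambient type \<open>'a\<close>, finite ones included, live in the same type. HOL cannot quantify over types inside a formula,
  so the class of all S-algebras is represented by \<open>algebras S\<close> at an arbitrary infinite \<open>'a\<close>;
  over a finite \<open>'a\<close> it would contain too few algebras for completeness.\<close>

locale K_algebra = bounded_lattice L for L :: "'a gorder" (structure) +
  fixes imp :: "'a \<Rightarrow> 'a \<Rightarrow> 'a" (infixr \<open>\<leadsto>\<close> 60)
  assumes imp_closed: "a \<in> carrier L \<Longrightarrow> b \<in> carrier L \<Longrightarrow> a \<leadsto> b \<in> carrier L"
    and P1: "a \<in> carrier L \<Longrightarrow> \<top> \<leadsto> a \<sqsubseteq> a"
    and P2: "\<lbrakk>a \<in> carrier L; b \<in> carrier L\<rbrakk> \<Longrightarrow> a \<sqinter> b \<sqsubseteq> a \<leadsto> b"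
    and P3: "\<lbrakk>a \<in> carrier L; b \<in> carrier L\<rbrakk> \<Longrightarrow> a \<leadsto> b \<sqsubseteq> a \<leadsto> (a \<sqinter> b)"
    and P4: "\<lbrakk>a \<in> carrier L; b \<in> carrier L; c \<in> carrier L\<rbrakk> \<Longrightarrow> a \<leadsto> (b \<sqinter> c) \<sqsubseteq> a \<leadsto> b"
    and P5: "\<lbrakk>a \<in> carrier L; b \<in> carrier L; c \<in> carrier L\<rbrakk> \<Longrightarrow>
      a \<leadsto> ((a \<sqinter> b) \<leadsto> c) \<sqsubseteq> (a \<sqinter> b) \<leadsto> c"
begin

abbreviation neg :: "'a \<Rightarrow> 'a"
  where "neg a \<equiv> a \<leadsto> \<bottom>"

end

locale T_algebra = K_algebra +
  assumes imp_refl: "a \<in> carrier L \<Longrightarrow> a \<leadsto> a = \<top>"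
    and meet_neg: "a \<in> carrier L \<Longrightarrow> a \<sqinter> neg a = \<bottom>"

locale F_algebra = T_algebra +
  assumes le_neg_neg: "a \<in> carrier L \<Longrightarrow> a \<sqsubseteq> neg (neg a)"

primrec algebras :: "sys \<Rightarrow> ('a gorder \<times> ('a \<Rightarrow> 'a \<Rightarrow> 'a)) set" where
  "algebras SysK = {(L, imp). K_algebra L imp}"
| "algebras SysT = {(L, imp). T_algebra L imp}"
| "algebras SysF = {(L, imp). F_algebra L imp}"

primrec eval :: "'a gorder \<Rightarrow> ('a \<Rightarrow> 'a \<Rightarrow> 'a) \<Rightarrow> ('p \<Rightarrow> 'a) \<Rightarrow> 'p form \<Rightarrow> 'a" where
  "eval L imp \<theta> (Var p) = \<theta> p"
| "eval L imp \<theta> \<^bold>\<bottom> = \<bottom>\<^bsub>L\<^esub>"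
| "eval L imp \<theta> \<^bold>\<top> = \<top>\<^bsub>L\<^esub>"
| "eval L imp \<theta> (\<phi> \<^bold>\<and> \<psi>) = eval L imp \<theta> \<phi> \<sqinter>\<^bsub>L\<^esub> eval L imp \<theta> \<psi>"
| "eval L imp \<theta> (\<phi> \<^bold>\<or> \<psi>) = eval L imp \<theta> \<phi> \<squnion>\<^bsub>L\<^esub> eval L imp \<theta> \<psi>"
| "eval L imp \<theta> (\<phi> \<^bold>\<longrightarrow> \<psi>) = imp (eval L imp \<theta> \<phi>) (eval L imp \<theta> \<psi>)"

definition consequence ::
  "('a gorder \<times> ('a \<Rightarrow> 'a \<Rightarrow> 'a)) set \<Rightarrow> 'p form set \<Rightarrow> 'p form \<Rightarrow> bool" where
  "consequence C \<Gamma> \<phi> \<longleftrightarrow>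
     (\<forall>(L, imp) \<in> C. \<forall>\<theta>. (\<forall>p. \<theta> p \<in> carrier L) \<longrightarrow>
        (\<exists>\<gamma>s. set \<gamma>s \<subseteq> \<Gamma> \<and>
          foldr (\<lambda>\<gamma> m. eval L imp \<theta> \<gamma> \<sqinter>\<^bsub>L\<^esub> m) \<gamma>s \<top>\<^bsub>L\<^esub> \<sqsubseteq>\<^bsub>L\<^esub> eval L imp \<theta> \<phi>))"

end

theory Submission
  imports Defs
begin

text \<open>
  Soundness. In a fixed algebra, the formulas whose value lies above a finite meet of values of
  \<open>\<Gamma>\<close> form a filter-like closure of \<open>\<Gamma>\<close>. Reflexivity and cut hold for this closure in every bounded
  lattice. All other rules involve sequents with at most two formulas to the left of the turnstile,
  and for them the closure collapses to an inequality between values; in particular the rule for disjunction,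
  which has no side formulas, says just that the join is a least upper bound. The only inequality that is not immediate from
  (P1)--(P5) is the one for the rule \<open>ImpR\<close>. It rests on cautious monotonicity
  (\<open>cautious_mono\<close>): if \<open>a \<sqinter> b \<sqsubseteq> c\<close> then \<open>a \<leadsto> b \<sqsubseteq> (c \<sqinter> a) \<leadsto> b\<close>.

  Completeness. The formulas modulo interderivability form an \<open>S\<close>-algebra in which the order is
  derivability between single formulas, and in which the canonical valuation sends every formula to
  its own class. If \<open>\<phi>\<close> follows from \<open>\<Gamma>\<close> over this algebra, some finite conjunction of members of
  \<open>\<Gamma>\<close> derives \<open>\<phi>\<close>, hence so does \<open>\<Gamma>\<close>. Since there are only countably many formulas, the classes can
  be named by elements of any infinite type, which turns the quotient into an algebra on that type.
\<close>

section \<open>Finite meets in bounded lattices\<close>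

context bounded_lattice
begin

definition finite_meet :: "('i \<Rightarrow> 'a) \<Rightarrow> 'i list \<Rightarrow> 'a" where
  "finite_meet f xs = foldr (\<lambda>x m. f x \<sqinter> m) xs \<top>"

definition entails :: "('i \<Rightarrow> 'a) \<Rightarrow> 'i set \<Rightarrow> 'i \<Rightarrow> bool" where
  "entails f X y \<longleftrightarrow> (\<exists>xs. set xs \<subseteq> X \<and> finite_meet f xs \<sqsubseteq> f y)"

context
  fixes f :: "'i \<Rightarrow> 'a"
  assumes f_closed: "\<And>x. f x \<in> carrier L"
begin

lemma finite_meet_closed: "finite_meet f xs \<in> carrier L"
  by (induction xs) (auto simp: finite_meet_def f_closed)

lemma finite_meet_lower: "x \<in> set xs \<Longrightarrow> finite_meet f xs \<sqsubseteq> f x"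
proof (induction xs)
  case (Cons y xs)
  have eq: "finite_meet f (y # xs) = f y \<sqinter> finite_meet f xs"
    by (simp add: finite_meet_def)
  have "f y \<sqinter> finite_meet f xs \<sqsubseteq> f y" "f y \<sqinter> finite_meet f xs \<sqsubseteq> finite_meet f xs"
    by (auto intro: meet_left meet_right f_closed finite_meet_closed)
  with Cons show ?case
    unfolding eq by (metis f_closed finite_meet_closed le_trans meet_closed set_ConsD)
qed simp

lemma finite_meet_greatest:
  assumes "a \<in> carrier L" "\<And>x. x \<in> set xs \<Longrightarrow> a \<sqsubseteq> f x"
  shows "a \<sqsubseteq> finite_meet f xs"
  using assms(2)
proof (induction xs)
  case Nil
  show ?case by (simp add: finite_meet_def top_higher assms(1))
next
  case (Cons y xs)
  then have "a \<sqsubseteq> f y \<sqinter> finite_meet f xs"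
    by (intro meet_le assms(1) f_closed finite_meet_closed) auto
  then show ?case by (simp add: finite_meet_def)
qed

lemma finite_meet_antimono: "set ys \<subseteq> set xs \<Longrightarrow> finite_meet f xs \<sqsubseteq> finite_meet f ys"
  by (intro finite_meet_greatest finite_meet_closed finite_meet_lower) auto

lemma entails_insert: "entails f (insert x X) x"
proof -
  have "finite_meet f [x] \<sqsubseteq> f x" by (rule finite_meet_lower) simp
  then show ?thesis unfolding entails_def by (intro exI[of _ "[x]"]) auto
qed

text \<open>In a list witnessing the first premise, the cut formula is dropped, and a list witnessing the
  second premise takes its place.\<close>

lemma entails_cut:
  assumes "entails f (insert z X) y" "entails f Y z"
  shows "entails f (X \<union> Y) y"
proof -
  obtain xs where xs: "set xs \<subseteq> insert z X" "finite_meet f xs \<sqsubseteq> f y"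
    using assms(1) unfolding entails_def by blast
  obtain ys where ys: "set ys \<subseteq> Y" "finite_meet f ys \<sqsubseteq> f z"
    using assms(2) unfolding entails_def by blast
  define zs where "zs = filter (\<lambda>x. x \<noteq> z) xs @ ys"
  have "finite_meet f zs \<sqsubseteq> finite_meet f ys"
    by (rule finite_meet_antimono) (auto simp: zs_def)
  then have z: "finite_meet f zs \<sqsubseteq> f z"
    using ys(2) by (rule le_trans) (auto intro: f_closed finite_meet_closed)
  have "finite_meet f zs \<sqsubseteq> finite_meet f xs"
  proof (rule finite_meet_greatest[OF finite_meet_closed])
    fix x assume "x \<in> set xs"
    then show "finite_meet f zs \<sqsubseteq> f x"
      using z by (cases "x = z") (auto simp: zs_def intro: finite_meet_lower)
  qed
  then have "finite_meet f zs \<sqsubseteq> f y"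
    using xs(2) by (rule le_trans) (auto intro: f_closed finite_meet_closed)
  moreover have "set zs \<subseteq> X \<union> Y" using xs(1) ys(1) by (auto simp: zs_def)
  ultimately show ?thesis unfolding entails_def by blast
qed

lemma entails_finite_iff: "entails f (set xs) y \<longleftrightarrow> finite_meet f xs \<sqsubseteq> f y"
proof
  assume "entails f (set xs) y"
  then obtain ys where "set ys \<subseteq> set xs" "finite_meet f ys \<sqsubseteq> f y"
    unfolding entails_def by blast
  then show "finite_meet f xs \<sqsubseteq> f y"
    using finite_meet_antimono le_trans f_closed finite_meet_closed by meson
qed (auto simp: entails_def)

lemma entails_empty_iff: "entails f {} y \<longleftrightarrow> \<top> \<sqsubseteq> f y"
  using entails_finite_iff[of "[]"] by (simp add: finite_meet_def)

lemma meet_top: "a \<in> carrier L \<Longrightarrow> a \<sqinter> \<top> = a"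
  using le_iff_join[of a \<top>] by (simp add: top_higher)

lemma entails_singleton_iff: "entails f {x} y \<longleftrightarrow> f x \<sqsubseteq> f y"
  using entails_finite_iff[of "[x]"] by (simp add: finite_meet_def meet_top f_closed)

lemma entails_pair_iff: "entails f {x, z} y \<longleftrightarrow> f x \<sqinter> f z \<sqsubseteq> f y"
  using entails_finite_iff[of "[x, z]"] by (simp add: finite_meet_def meet_top f_closed)

end

end

section \<open>Soundness\<close>

context K_algebra
begin

text \<open>The inequality behind the rule \<open>Con\<close>: (P3) puts the antecedent into the consequent, and (P4)
  weakens the result to \<open>c\<close>, of which \<open>a \<sqinter> b\<close> is a conjunct.\<close>

lemma imp_mono:
  assumes "a \<in> carrier L" "b \<in> carrier L" "c \<in> carrier L" "a \<sqinter> b \<sqsubseteq> c"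
  shows "a \<leadsto> b \<sqsubseteq> a \<leadsto> c"
proof -
  have "c \<sqinter> (a \<sqinter> b) = a \<sqinter> b"
    using assms le_iff_join[of "a \<sqinter> b" c] by (simp add: meet_comm[of L c])
  then have "a \<leadsto> (a \<sqinter> b) \<sqsubseteq> a \<leadsto> c"
    using P4[of a c "a \<sqinter> b"] assms(1-3) by simp
  then show ?thesis
    by (rule le_trans[OF P3[OF assms(1,2)]]) (simp_all add: assms imp_closed)
qed

text \<open>By (P2), \<open>a \<sqinter> b\<close> lies below \<open>(a \<sqinter> c) \<leadsto> b\<close>, so \<open>imp_mono\<close> inserts this conditional under the
  antecedent \<open>a\<close>; (P5) then removes the outer antecedent.\<close>

lemma cautious_mono:
  assumes "a \<in> carrier L" "b \<in> carrier L" "c \<in> carrier L" "a \<sqinter> b \<sqsubseteq> c"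
  shows "a \<leadsto> b \<sqsubseteq> (c \<sqinter> a) \<leadsto> b"
proof -
  have ac: "a \<sqinter> c \<in> carrier L" and imp: "(a \<sqinter> c) \<leadsto> b \<in> carrier L"
    using assms by (auto intro: imp_closed)
  have "a \<sqinter> b \<sqsubseteq> (a \<sqinter> c) \<sqinter> b"
    by (intro meet_le assms ac meet_closed meet_left meet_right)
  also have "(a \<sqinter> c) \<sqinter> b \<sqsubseteq> (a \<sqinter> c) \<leadsto> b"
    by (rule P2[OF ac assms(2)])
  finally have "a \<sqinter> b \<sqsubseteq> (a \<sqinter> c) \<leadsto> b"
    using assms ac imp by simp
  then have "a \<leadsto> b \<sqsubseteq> a \<leadsto> ((a \<sqinter> c) \<leadsto> b)"
    by (rule imp_mono[OF assms(1,2) imp])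
  also have "\<dots> \<sqsubseteq> (a \<sqinter> c) \<leadsto> b"
    by (rule P5[OF assms(1,3,2)])
  finally show ?thesis
    using assms imp by (simp add: imp_closed meet_comm)
qed

text \<open>The inequality behind the rule \<open>ImpR\<close>: cautious monotonicity weakens the consequent
  \<open>a \<leadsto> b\<close> to \<open>(c \<sqinter> a) \<leadsto> b\<close>, and then (P5) applies.\<close>

lemma imp_import:
  assumes "a \<in> carrier L" "b \<in> carrier L" "c \<in> carrier L" "a \<sqinter> b \<sqsubseteq> c"
  shows "c \<leadsto> (a \<leadsto> b) \<sqsubseteq> (c \<sqinter> a) \<leadsto> b"
proof -
  have closed: "a \<leadsto> b \<in> carrier L" "(c \<sqinter> a) \<leadsto> b \<in> carrier L"
    using assms by (auto intro: imp_closed)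
  have "c \<sqinter> (a \<leadsto> b) \<sqsubseteq> a \<leadsto> b"
    by (rule meet_right[OF assms(3) closed(1)])
  then have "c \<sqinter> (a \<leadsto> b) \<sqsubseteq> (c \<sqinter> a) \<leadsto> b"
    using cautious_mono[OF assms] by (rule le_trans) (use assms closed in auto)
  then have "c \<leadsto> (a \<leadsto> b) \<sqsubseteq> c \<leadsto> ((c \<sqinter> a) \<leadsto> b)"
    by (rule imp_mono[OF assms(3) closed])
  then show ?thesis
    using P5[OF assms(3,1,2)] by (rule le_trans) (use assms closed in \<open>auto intro: imp_closed\<close>)
qed

lemma eval_closed:
  assumes "\<And>p. \<theta> p \<in> carrier L"
  shows "eval L imp \<theta> \<phi> \<in> carrier L"
  by (induction \<phi>) (auto simp: assms imp_closed)

lemma derives_entails: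
  assumes alg: "(L, imp) \<in> algebras S" and \<theta>: "\<And>p. \<theta> p \<in> carrier L"
    and "derives S \<Gamma> \<phi>"
  shows "entails (eval L imp \<theta>) \<Gamma> \<phi>"
proof -
  let ?e = "eval L imp \<theta>"
  have closed: "?e \<phi> \<in> carrier L" for \<phi>
    by (rule eval_closed[OF \<theta>])
  note iffs = entails_empty_iff[of ?e, OF closed] entails_singleton_iff[of ?e, OF closed]
    entails_pair_iff[of ?e, OF closed]
  have T: "T_algebra L imp" if "S \<in> {SysT, SysF}"
    using that alg by (cases S) (auto dest: F_algebra.axioms)
  from \<open>derives S \<Gamma> \<phi>\<close> show ?thesis
  proof induction
    case (Ax \<phi> \<Gamma>)
    show ?case by (rule entails_insert[OF closed])
  next
    case (Cut \<psi> \<Gamma> \<phi> \<Delta>)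
    then show ?case by (intro entails_cut[OF closed])
  next
    case (AndI \<phi> \<psi>)
    show ?case by (simp add: iffs closed)
  next
    case (AndE1 \<phi> \<psi>)
    show ?case by (simp add: iffs closed meet_left)
  next
    case (AndE2 \<phi> \<psi>)
    show ?case by (simp add: iffs closed meet_right)
  next
    case (OrI1 \<phi> \<psi>)
    show ?case by (simp add: iffs closed join_left)
  next
    case (OrI2 \<psi> \<phi>)
    show ?case by (simp add: iffs closed join_right)
  next
    case (OrE \<phi> \<alpha> \<psi>)
    then show ?case by (simp add: iffs closed join_le)
  next
    case (BotE \<phi>)
    show ?case by (simp add: iffs closed bottom_lower)
  next
    case TopI
    show ?case by (simp add: iffs)
  next
    case (TopImpE \<phi>)
    show ?case by (simp add: iffs closed P1)
  next
    case (Con \<alpha> \<beta> \<psi>)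
    then show ?case by (simp add: iffs closed imp_mono)
  next
    case (AndImp \<alpha> \<beta>)
    show ?case by (simp add: iffs closed P2)
  next
    case (ImpR \<alpha> \<beta> \<phi>)
    then show ?case by (simp add: iffs closed imp_import)
  next
    case (Rep \<alpha> \<alpha>' \<beta>)
    then have "?e \<alpha> = ?e \<alpha>'" by (auto simp: iffs closed)
    then show ?case by (simp add: iffs closed imp_closed)
  next
    case (ImpId \<alpha>)
    interpret T_algebra L imp by (rule T[OF ImpId])
    show ?case by (simp add: iffs closed imp_refl)
  next
    case (Exp \<alpha>)
    interpret T_algebra L imp by (rule T[OF Exp])
    show ?case by (simp add: iffs closed meet_neg)
  next
    case (NegNegI \<alpha>)
    with alg interpret F_algebra L imp by simp
    show ?case by (simp add: iffs closed le_neg_neg)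
  qed
qed

end

lemma algebras_K_algebra: "(L, imp) \<in> algebras S \<Longrightarrow> K_algebra L imp"
  by (cases S) (auto dest: F_algebra.axioms T_algebra.axioms)

theorem soundness:
  fixes \<Gamma> :: "'p form set"
  assumes "derives S \<Gamma> \<phi>"
  shows "consequence (algebras S :: ('a gorder \<times> _) set) \<Gamma> \<phi>"
  unfolding consequence_def
proof (clarify)
  fix L :: "'a gorder" and imp :: "'a \<Rightarrow> 'a \<Rightarrow> 'a" and \<theta> :: "'p \<Rightarrow> 'a"
  assume alg: "(L, imp) \<in> algebras S" and \<theta>: "\<forall>p. \<theta> p \<in> carrier L"
  interpret K_algebra L imp by (rule algebras_K_algebra[OF alg])
  from derives_entails[OF alg _ assms, of \<theta>] \<theta>
  show "\<exists>\<gamma>s. set \<gamma>s \<subseteq> \<Gamma> \<and>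
      foldr (\<lambda>\<gamma> m. eval L imp \<theta> \<gamma> \<sqinter>\<^bsub>L\<^esub> m) \<gamma>s \<top>\<^bsub>L\<^esub> \<sqsubseteq>\<^bsub>L\<^esub> eval L imp \<theta> \<phi>"
    unfolding entails_def finite_meet_def by blast
qed

section \<open>Derived rules\<close>

lemma derives_weaken:
  assumes "derives S \<Gamma> \<phi>" "\<Gamma> \<subseteq> \<Delta>"
  shows "derives S \<Delta> \<phi>"
proof -
  have "derives S (\<Delta> \<union> \<Gamma>) \<phi>"
    by (rule Cut[OF Ax assms(1)])
  with assms(2) show ?thesis by (simp add: Un_absorb2)
qed

lemma derives_trans: "derives S \<Gamma> \<phi> \<Longrightarrow> derives S {\<phi>} \<psi> \<Longrightarrow> derives S \<Gamma> \<psi>"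
  using Cut[of S \<phi> "{}" \<psi> \<Gamma>] by simp

lemma derives_mem: "\<phi> \<in> \<Gamma> \<Longrightarrow> derives S \<Gamma> \<phi>"
  by (metis Ax insert_absorb)

lemma derives_cut_pair:
  assumes "derives S {\<phi>, \<psi>} \<chi>" "derives S \<Gamma> \<phi>" "derives S \<Gamma> \<psi>"
  shows "derives S \<Gamma> \<chi>"
proof -
  have "derives S (insert \<psi> \<Gamma>) \<chi>"
    using Cut[OF assms(1,2)] by simp
  from Cut[OF this assms(3)] show ?thesis by simp
qed

lemmas derives_And = derives_cut_pair[OF AndI]

lemma derives_Top: "derives S \<Gamma> \<^bold>\<top>"
  by (rule derives_weaken[OF TopI]) simp

lemma derives_conjuncts:
  "derives S \<Gamma> (\<phi> \<^bold>\<and> \<psi>) \<Longrightarrow> derives S \<Gamma> \<phi>"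
  "derives S \<Gamma> (\<phi> \<^bold>\<and> \<psi>) \<Longrightarrow> derives S \<Gamma> \<psi>"
  by (erule derives_trans, rule AndE1) (erule derives_trans, rule AndE2)

text \<open>This is the syntactic form of (P5). \<open>ImpR\<close> yields it with the antecedent \<open>\<alpha> \<^bold>\<and> (\<alpha> \<^bold>\<and> \<beta>)\<close>, which
  \<open>Rep\<close> contracts to \<open>\<alpha> \<^bold>\<and> \<beta>\<close>.\<close>

lemma derives_imp_And_left:
  "derives S {\<alpha> \<^bold>\<longrightarrow> ((\<alpha> \<^bold>\<and> \<beta>) \<^bold>\<longrightarrow> \<gamma>)} ((\<alpha> \<^bold>\<and> \<beta>) \<^bold>\<longrightarrow> \<gamma>)"
proof -
  have refl: "derives S {\<delta>} \<delta>" for \<delta> :: "'a form"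
    by (rule derives_mem) simp
  have "derives S {(\<alpha> \<^bold>\<and> \<beta>) \<^bold>\<and> \<gamma>} \<alpha>"
    by (metis derives_conjuncts(1) refl)
  from ImpR[OF this]
  have "derives S {\<alpha> \<^bold>\<longrightarrow> ((\<alpha> \<^bold>\<and> \<beta>) \<^bold>\<longrightarrow> \<gamma>)} ((\<alpha> \<^bold>\<and> (\<alpha> \<^bold>\<and> \<beta>)) \<^bold>\<longrightarrow> \<gamma>)" .
  moreover have "derives S {(\<alpha> \<^bold>\<and> (\<alpha> \<^bold>\<and> \<beta>)) \<^bold>\<longrightarrow> \<gamma>} ((\<alpha> \<^bold>\<and> \<beta>) \<^bold>\<longrightarrow> \<gamma>)"
    by (intro Rep AndE2 derives_And AndE1 refl)
  ultimately show ?thesis by (rule derives_trans)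
qed

section \<open>The Lindenbaum algebra\<close>

text \<open>The element \<open>name \<phi>\<close> stands for the interderivability class of \<open>\<phi>\<close>. Working with names instead
  of classes places the quotient on the type \<open>'a\<close> from the outset.\<close>

locale lindenbaum =
  fixes S :: sys and name :: "'p form \<Rightarrow> 'a"
  assumes name_eq_iff: "name \<phi> = name \<psi> \<longleftrightarrow> derives S {\<phi>} \<psi> \<and> derives S {\<psi>} \<phi>"
begin

definition lattice_of_names :: "'a gorder" where
  "lattice_of_names =
    \<lparr>carrier = range name, eq = (=),
     le = (\<lambda>x y. \<exists>\<phi> \<psi>. x = name \<phi> \<and> y = name \<psi> \<and> derives S {\<phi>} \<psi>)\<rparr>"

definition imp_of_names :: "'a \<Rightarrow> 'a \<Rightarrow> 'a" where
  "imp_of_names x y = name (inv name x \<^bold>\<longrightarrow> inv name y)"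

abbreviation (input) "LN \<equiv> lattice_of_names"

lemma carrier_names [simp]: "carrier LN = range name"
  and eq_names [simp]: "eq LN = (=)"
  by (simp_all add: lattice_of_names_def)

lemma le_names [simp]: "name \<phi> \<sqsubseteq>\<^bsub>LN\<^esub> name \<psi> \<longleftrightarrow> derives S {\<phi>} \<psi>"
proof
  assume "name \<phi> \<sqsubseteq>\<^bsub>LN\<^esub> name \<psi>"
  then obtain \<phi>' \<psi>' where "name \<phi> = name \<phi>'" "name \<psi> = name \<psi>'" "derives S {\<phi>'} \<psi>'"
    by (auto simp: lattice_of_names_def)
  then show "derives S {\<phi>} \<psi>"
    unfolding name_eq_iff by (meson derives_trans)
qed (auto simp: lattice_of_names_def)

text \<open>Interderivability is a congruence for the conditional: \<open>Con\<close> replaces the consequent and \<open>Rep\<close>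
  the antecedent. Hence the representatives picked by \<open>inv name\<close> do not matter.\<close>

lemma imp_names [simp]: "imp_of_names (name \<alpha>) (name \<beta>) = name (\<alpha> \<^bold>\<longrightarrow> \<beta>)"
proof -
  have imp_cong: "derives S {\<alpha> \<^bold>\<longrightarrow> \<beta>} (\<alpha>' \<^bold>\<longrightarrow> \<beta>')"
    if "name \<alpha> = name \<alpha>'" "name \<beta> = name \<beta>'" for \<alpha> \<alpha>' \<beta> \<beta>'
  proof -
    have "derives S {\<alpha> \<^bold>\<longrightarrow> \<beta>} (\<alpha> \<^bold>\<longrightarrow> \<beta>')"
      using that(2) by (intro Con derives_trans[OF AndE2]) (simp add: name_eq_iff)
    moreover have "derives S {\<alpha> \<^bold>\<longrightarrow> \<beta>'} (\<alpha>' \<^bold>\<longrightarrow> \<beta>')"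
      using that(1) by (intro Rep) (simp_all add: name_eq_iff)
    ultimately show ?thesis by (rule derives_trans)
  qed
  have "name (inv name (name \<phi>)) = name \<phi>" for \<phi>
    by (simp add: f_inv_into_f)
  then show ?thesis
    unfolding imp_of_names_def name_eq_iff[of "_ \<^bold>\<longrightarrow> _"] by (intro conjI imp_cong) simp_all
qed

lemma names_partial_order: "partial_order LN"
proof
  fix x y z assume "x \<in> carrier LN" "y \<in> carrier LN" "z \<in> carrier LN"
  then obtain \<phi> \<psi> \<chi> where [simp]: "x = name \<phi>" "y = name \<psi>" "z = name \<chi>" by auto
  show "x \<sqsubseteq>\<^bsub>LN\<^esub> z" if "x \<sqsubseteq>\<^bsub>LN\<^esub> y" "y \<sqsubseteq>\<^bsub>LN\<^esub> z"
    using that derives_trans by auto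
  show "x .=\<^bsub>LN\<^esub> y" if "x \<sqsubseteq>\<^bsub>LN\<^esub> y" "y \<sqsubseteq>\<^bsub>LN\<^esub> x"
    using that by (simp add: name_eq_iff)
qed (auto intro: derives_mem)

lemma greatest_names: "greatest LN (name (\<phi> \<^bold>\<and> \<psi>)) (Lower LN {name \<phi>, name \<psi>})"
proof -
  have "Lower LN {name \<phi>, name \<psi>} = name ` {\<chi>. derives S {\<chi>} \<phi> \<and> derives S {\<chi>} \<psi>}"
    by (force simp: Lower_def)
  then show ?thesis
    by (auto simp: greatest_def intro: derives_And AndE1 AndE2)
qed

lemma least_names: "least LN (name (\<phi> \<^bold>\<or> \<psi>)) (Upper LN {name \<phi>, name \<psi>})"
proof -
  have "Upper LN {name \<phi>, name \<psi>} = name ` {\<chi>. derives S {\<phi>} \<chi> \<and> derives S {\<psi>} \<chi>}"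
    by (force simp: Upper_def)
  then show ?thesis
    by (auto simp: least_def intro: OrI1 OrI2 OrE)
qed

lemma top_greatest_names: "greatest LN (name \<^bold>\<top>) (carrier LN)"
  by (auto simp: greatest_def intro: derives_Top)

lemma bottom_least_names: "least LN (name \<^bold>\<bottom>) (carrier LN)"
  by (auto simp: least_def intro: BotE)

sublocale names: bounded_lattice LN
proof -
  interpret partial_order LN by (rule names_partial_order)
  show "bounded_lattice LN"
  proof
    fix x y assume "x \<in> carrier LN" "y \<in> carrier LN"
    then obtain \<phi> \<psi> where "x = name \<phi>" "y = name \<psi>" by auto
    then show "\<exists>s. least LN s (Upper LN {x, y})" "\<exists>s. greatest LN s (Lower LN {x, y})"
      using least_names greatest_names by blast+
  qed (use top_greatest_names bottom_least_names in blast)+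
qed

lemma meet_names [simp]: "name \<phi> \<sqinter>\<^bsub>LN\<^esub> name \<psi> = name (\<phi> \<^bold>\<and> \<psi>)"
proof (rule names.meetI)
  show "i = name (\<phi> \<^bold>\<and> \<psi>)" if "greatest LN i (Lower LN {name \<phi>, name \<psi>})" for i
    using that greatest_names by (rule names.greatest_unique)
qed auto

lemma join_names [simp]: "name \<phi> \<squnion>\<^bsub>LN\<^esub> name \<psi> = name (\<phi> \<^bold>\<or> \<psi>)"
proof (rule names.joinI)
  show "s = name (\<phi> \<^bold>\<or> \<psi>)" if "least LN s (Upper LN {name \<phi>, name \<psi>})" for s
    using that least_names by (rule names.least_unique)
qed auto

lemma top_names [simp]: "\<top>\<^bsub>LN\<^esub> = name \<^bold>\<top>"
  using names.top_greatest top_greatest_names by (rule names.greatest_unique)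

lemma bottom_names [simp]: "\<bottom>\<^bsub>LN\<^esub> = name \<^bold>\<bottom>"
  using names.bottom_least bottom_least_names by (rule names.least_unique)

lemma names_K_algebra: "K_algebra LN imp_of_names"
proof
  fix a b c assume "a \<in> carrier LN" "b \<in> carrier LN" "c \<in> carrier LN"
  then obtain \<alpha> \<beta> \<gamma> where [simp]: "a = name \<alpha>" "b = name \<beta>" "c = name \<gamma>" by auto
  show "imp_of_names a (b \<sqinter>\<^bsub>LN\<^esub> c) \<sqsubseteq>\<^bsub>LN\<^esub> imp_of_names a b"
    by (simp add: Con derives_trans[OF AndE2 AndE1])
  show "imp_of_names a (imp_of_names (a \<sqinter>\<^bsub>LN\<^esub> b) c) \<sqsubseteq>\<^bsub>LN\<^esub> imp_of_names (a \<sqinter>\<^bsub>LN\<^esub> b) c"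
    by (simp add: derives_imp_And_left)
qed (auto simp: TopImpE AndImp Con derives_mem)

lemma names_T_algebra:
  assumes "S \<in> {SysT, SysF}"
  shows "T_algebra LN imp_of_names"
proof -
  interpret K_algebra LN imp_of_names by (rule names_K_algebra)
  show ?thesis
  proof
    fix a assume "a \<in> carrier LN"
    then obtain \<alpha> where [simp]: "a = name \<alpha>" by auto
    have "derives S {\<^bold>\<top>} (\<alpha> \<^bold>\<longrightarrow> \<alpha>)"
      by (rule derives_weaken[OF ImpId[OF assms]]) simp
    then show "imp_of_names a a = \<top>\<^bsub>LN\<^esub>"
      by (simp add: name_eq_iff derives_Top)
    have "derives S {\<alpha> \<^bold>\<and> \<^bold>\<not> \<alpha>} \<^bold>\<bottom>"
      by (rule derives_cut_pair[OF Exp[OF assms] AndE1 AndE2])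
    then show "a \<sqinter>\<^bsub>LN\<^esub> imp_of_names a \<bottom>\<^bsub>LN\<^esub> = \<bottom>\<^bsub>LN\<^esub>"
      by (simp add: name_eq_iff BotE)
  qed
qed

lemma names_F_algebra:
  assumes "S = SysF"
  shows "F_algebra LN imp_of_names"
proof -
  interpret T_algebra LN imp_of_names by (rule names_T_algebra) (simp add: assms)
  show ?thesis by unfold_locales (auto intro: NegNegI[OF assms])
qed

text \<open>The rules specific to T and F are the defining laws of the corresponding algebras, read
  modulo interderivability.\<close>

lemma names_algebras: "(LN, imp_of_names) \<in> algebras S"
  using names_K_algebra names_T_algebra names_F_algebra by (cases S) auto

lemma eval_names: "eval LN imp_of_names (\<lambda>p. name (Var p)) \<phi> = name \<phi>"
  by (induction \<phi>) auto

lemma finite_meet_names: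
  obtains \<chi> where "names.finite_meet name \<gamma>s = name \<chi>" "derives S (set \<gamma>s) \<chi>"
proof -
  have "\<exists>\<chi>. names.finite_meet name \<gamma>s = name \<chi> \<and> derives S (set \<gamma>s) \<chi>"
  proof (induction \<gamma>s)
    case Nil
    show ?case by (auto simp: names.finite_meet_def intro: TopI)
  next
    case (Cons \<gamma> \<gamma>s)
    then obtain \<chi> where \<chi>: "names.finite_meet name \<gamma>s = name \<chi>" "derives S (set \<gamma>s) \<chi>" by blast
    have "derives S (set (\<gamma> # \<gamma>s)) (\<gamma> \<^bold>\<and> \<chi>)"
      by (intro derives_And derives_mem derives_weaken[OF \<chi>(2)]) auto
    moreover have "names.finite_meet name (\<gamma> # \<gamma>s) = name (\<gamma> \<^bold>\<and> \<chi>)"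
      using \<chi>(1) by (simp add: names.finite_meet_def)
    ultimately show ?case by blast
  qed
  then show ?thesis using that by blast
qed

theorem consequence_imp_derives:
  fixes \<Gamma> :: "'p form set"
  assumes "consequence (algebras S :: ('a gorder \<times> _) set) \<Gamma> \<phi>"
  shows "derives S \<Gamma> \<phi>"
proof -
  have "\<exists>\<gamma>s. set \<gamma>s \<subseteq> \<Gamma> \<and> names.finite_meet name \<gamma>s \<sqsubseteq>\<^bsub>LN\<^esub> name \<phi>"
    using bspec[OF assms[unfolded consequence_def] names_algebras]
    by (auto dest!: spec[of _ "\<lambda>p. name (Var p)"] simp: eval_names names.finite_meet_def)
  then obtain \<gamma>s where \<gamma>s: "set \<gamma>s \<subseteq> \<Gamma>" "names.finite_meet name \<gamma>s \<sqsubseteq>\<^bsub>LN\<^esub> name \<phi>" by blast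
  obtain \<chi> where "names.finite_meet name \<gamma>s = name \<chi>" "derives S (set \<gamma>s) \<chi>"
    by (rule finite_meet_names)
  with \<gamma>s have "derives S (set \<gamma>s) \<phi>" by (auto intro: derives_trans)
  then show ?thesis using \<gamma>s(1) by (rule derives_weaken)
qed

end

section \<open>Completeness\<close>

instance form :: (countable) countable
  by countable_datatype

text \<open>A name is obtained by choosing one formula in each interderivability class and injecting the
  countably many chosen formulas into the infinite type.\<close>

lemma lindenbaum_name_exists:
  assumes "infinite (UNIV :: 'a set)"
  obtains name :: "('p :: countable) form \<Rightarrow> 'a" where "lindenbaum S name"
proof -
  obtain g :: "nat \<Rightarrow> 'a" where g: "inj g"
    using assms infinite_countable_subset by blast
  define rep :: "'p form \<Rightarrow> 'p form"
    where "rep \<phi> = (SOME \<chi>. derives S {\<phi>} \<chi> \<and> derives S {\<chi>} \<phi>)" for \<phi>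
  have rep: "derives S {\<phi>} (rep \<phi>) \<and> derives S {rep \<phi>} \<phi>" for \<phi>
    unfolding rep_def by (rule someI[of _ \<phi>]) (simp add: derives_mem)
  have "rep \<phi> = rep \<psi> \<longleftrightarrow> derives S {\<phi>} \<psi> \<and> derives S {\<psi>} \<phi>" for \<phi> \<psi>
  proof
    assume "rep \<phi> = rep \<psi>"
    with rep[of \<phi>] rep[of \<psi>] show "derives S {\<phi>} \<psi> \<and> derives S {\<psi>} \<phi>"
      by (metis derives_trans)
  next
    assume "derives S {\<phi>} \<psi> \<and> derives S {\<psi>} \<phi>"
    then have "(\<lambda>\<chi>. derives S {\<phi>} \<chi> \<and> derives S {\<chi>} \<phi>) = (\<lambda>\<chi>. derives S {\<psi>} \<chi> \<and> derives S {\<chi>} \<psi>)"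
      by (blast intro: derives_trans)
    then show "rep \<phi> = rep \<psi>" by (simp add: rep_def)
  qed
  then have "lindenbaum S (\<lambda>\<phi>. g (to_nat (rep \<phi>)))"
    by unfold_locales (simp add: inj_eq[OF g])
  then show ?thesis by (rule that)
qed

theorem theorem3p10:
  fixes S :: sys
    and \<Gamma> :: "('p :: countable) form set"
    and \<phi> :: "'p form"
  assumes "infinite (UNIV :: 'a set)"
  shows "derives S \<Gamma> \<phi> \<longleftrightarrow>
    consequence (algebras S :: ('a gorder \<times> ('a \<Rightarrow> 'a \<Rightarrow> 'a)) set) \<Gamma> \<phi>"
proof
  assume "consequence (algebras S :: ('a gorder \<times> ('a \<Rightarrow> 'a \<Rightarrow> 'a)) set) \<Gamma> \<phi>"
  moreover obtain name :: "'p form \<Rightarrow> 'a" where "lindenbaum S name"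
    using lindenbaum_name_exists[OF assms] .
  ultimately show "derives S \<Gamma> \<phi>"
    by (rule lindenbaum.consequence_imp_derives[rotated])
qed (rule soundness)

end
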